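(* Let $k \geq 2$ be a fixed integer. Then the function $\omega_k(f)$ does not have normal order $G(f)$ for any non-decreasing function $G : M \to \mathbb{R}_{\geq 0}$.
   Context: $\mathbb{F}_q$ is the finite field with $q$ elements ($q$ a fixed prime power), and $\mathbb{F}_q[t]$ is its polynomial ring. $P$ is the set of monic irreducible polynomials in $\mathbb{F}_q[t]$; $M$ is the set of monic polynomials of degree $\ge 1$; for $n \ge 1$, $M_n$ is the set of monic polynomials of degree $n$. For $l \in P$ and $f \in M$, $\nu_l(f)$ is the largest nonnegative integer with $l^{\nu_l(f)} \mid f$, and $\omega_k(f)$ is the number of $l \in P$ with $\nu_l(f) = k$. Normal order: let $g, G : M \to \mathbb{R}_{\geq 0}$. $G$ is non-decreasing if $G(f) \geq G(h)$ for all $f, h \in M$ with $\deg(f) \geq \deg(h)$. For a non-decreasing $G$, $g(f)$ is said to have normal order $G(f)$ if for any $\epsilon > 0$, the number of $f \in M_n$ that do not satisfy $(1-\epsilon) G(f) \leq g(f) \leq (1+\epsilon) G(f)$ is $o(q^n)$ as $n \to \infty$. *)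

theory Defs
  imports
    "HOL-Computational_Algebra.Computational_Algebra"
    "HOL-Library.Cardinality"
    "HOL-Library.Landau_Symbols"
begin

text \<open>
  The finite field with \<open>q\<close> elements is a type \<open>'a\<close> of classes \<open>finite\<close> and \<open>field\<close>,
  with \<open>q = CARD('a)\<close>; the ring of polynomials over it is \<open>'a poly\<close>.
\<close>

definition monic_irreducibles :: "'a::{finite,field} poly set" where
  "monic_irreducibles = {l. lead_coeff l = 1 \<and> irreducible l}"

definition monics :: "'a::{finite,field} poly set" where
  "monics = {f. lead_coeff f = 1 \<and> degree f \<ge> 1}"

definition monics_of_degree :: "nat \<Rightarrow> 'a::{finite,field} poly set" where
  "monics_of_degree n = {f. lead_coeff f = 1 \<and> degree f = n}"

text \<open>
  The library's \<open>multiplicity\<close> needs the type class \<open>factorial_semiring\<close>, which is not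
  available for polynomials over an arbitrary field. For irreducible \<open>l\<close> and nonzero \<open>f\<close> the
  exponents \<open>m\<close> below are bounded by \<open>degree f\<close>, so the maximum exists.
\<close>

definition nu :: "'a::{finite,field} poly \<Rightarrow> 'a poly \<Rightarrow> nat" where
  "nu l f = (GREATEST m. l ^ m dvd f)"

text \<open>
  For \<open>k = 0\<close> the set below is infinite and its \<open>card\<close> is the junk value 0;
  for \<open>f\<close> in \<open>monics\<close> and \<open>k \<ge> 1\<close> it is finite, and \<open>\<omega>\<^sub>k\<close> has its intended meaning.
\<close>

definition omega :: "nat \<Rightarrow> 'a::{finite,field} poly \<Rightarrow> nat" where
  "omega k f = card {l \<in> monic_irreducibles. nu l f = k}"

text \<open>
  A function from \<open>monics\<close> to the nonnegative reals is a total function on \<open>'a poly\<close> of which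
  only the values on \<open>monics\<close> matter. The monotonicity condition compares
  degrees with \<open>\<ge>\<close>, so it makes such a function constant on each degree.
\<close>

definition nonneg_on_monics :: "('a::{finite,field} poly \<Rightarrow> real) \<Rightarrow> bool" where
  "nonneg_on_monics G \<longleftrightarrow> (\<forall>f\<in>monics. G f \<ge> 0)"

definition non_decreasing :: "('a::{finite,field} poly \<Rightarrow> real) \<Rightarrow> bool" where
  "non_decreasing G \<longleftrightarrow> (\<forall>f\<in>monics. \<forall>h\<in>monics. degree f \<ge> degree h \<longrightarrow> G f \<ge> G h)"

definition has_normal_order ::
  "('a::{finite,field} poly \<Rightarrow> real) \<Rightarrow> ('a poly \<Rightarrow> real) \<Rightarrow> bool" where
  "has_normal_order g G \<longleftrightarrow>
     (\<forall>\<epsilon>>0. (\<lambda>n. real (card {f \<in> monics_of_degree n.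
                 \<not> ((1 - \<epsilon>) * G f \<le> g f \<and> g f \<le> (1 + \<epsilon>) * G f)}))
            \<in> o(\<lambda>n. real CARD('a) ^ n))"

end

theory Submission
  imports Defs
begin

text \<open>
  A non-decreasing \<open>G\<close> is constant on the monic polynomials of degree \<open>n\<close>. It therefore cannot be
  a normal order of \<open>\<omega>\<^sub>k\<close> once both events \<open>\<omega>\<^sub>k(f) = 0\<close> and \<open>\<omega>\<^sub>k(f) > 0\<close> have a proportion
  bounded away from \<open>0\<close> among these polynomials: for \<open>\<epsilon> < 1\<close>, the first forces the constant
  value of \<open>G\<close> to be at most \<open>0\<close>, and the second then contradicts the upper bound \<open>\<omega>\<^sub>k(f) \<le> (1 + \<epsilon>) G(f)\<close>.

  The polynomials \<open>t\<^sup>k h\<close> with \<open>h(0) \<noteq> 0\<close> satisfy \<open>\<omega>\<^sub>k > 0\<close>, and make up a proportion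
  \<open>(1 - 1/q) q\<^sup>-\<^sup>k\<close> in every degree above \<open>k\<close> (\<open>card_omega_pos_ge\<close>).

  If \<open>\<omega>\<^sub>k(f) > 0\<close> with \<open>k \<ge> 2\<close>, then \<open>f\<close> is divisible by the square of a nonconstant monic
  \<open>l\<close>, so either \<open>t\<^sup>2\<close> divides \<open>f\<close> or one may take \<open>l(0) \<noteq> 0\<close>. There are
  \<open>(q - 1) q\<^sup>d\<^sup>-\<^sup>1\<close> candidates \<open>l\<close> of degree \<open>d \<ge> 1\<close> with \<open>l(0) \<noteq> 0\<close>, so the union bound is
  \<open>q\<^sup>n\<^sup>-\<^sup>2 + (\<Sum>d. (q - 1) q\<^sup>d\<^sup>-\<^sup>1 q\<^sup>n\<^sup>-\<^sup>2\<^sup>d) \<le> q\<^sup>n\<^sup>-\<^sup>2 + q\<^sup>n\<^sup>-\<^sup>1 \<le> (3/4) q\<^sup>n\<close>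
  (\<open>card_square_divisor_le\<close>), and the event \<open>\<omega>\<^sub>k = 0\<close> has proportion at least \<open>1/4\<close>
  in every degree \<open>n \<ge> 2\<close> (\<open>card_omega_0_ge\<close>). Separating off the divisor \<open>t\<close> is what makes the bound nontrivial for \<open>q = 2\<close>.
\<close>

section \<open>Counting monic polynomials\<close>

lemma card_field_ge_2: "CARD('a::{finite,field}) \<ge> 2"
proof -
  have "card {0, 1::'a} \<le> CARD('a)" by (intro card_mono) auto
  then show ?thesis by simp
qed

lemma monics_of_degree_0: "monics_of_degree 0 = {1 :: 'a::{finite,field} poly}"
  by (auto simp: monics_of_degree_def elim!: degree_eq_zeroE)

lemma pCons_in_monics_of_degree_iff:
  "pCons a f \<in> monics_of_degree (Suc n) \<longleftrightarrow> f \<in> monics_of_degree n"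
  by (auto simp: monics_of_degree_def)

lemma finite_card_monics_of_degree:
  "finite (monics_of_degree n :: 'a::{finite,field} poly set) \<and>
   card (monics_of_degree n :: 'a poly set) = CARD('a) ^ n"
proof (induction n)
  case 0
  then show ?case by (simp add: monics_of_degree_0)
next
  case (Suc n)
  have eq: "(monics_of_degree (Suc n) :: 'a poly set) =
      (\<lambda>(a, f). pCons a f) ` (UNIV \<times> monics_of_degree n)"
  proof (intro set_eqI iffI)
    fix p :: "'a poly"
    assume "p \<in> monics_of_degree (Suc n)"
    then show "p \<in> (\<lambda>(a, f). pCons a f) ` (UNIV \<times> monics_of_degree n)"
      by (cases p) (auto simp: pCons_in_monics_of_degree_iff)
  qed (auto simp: pCons_in_monics_of_degree_iff)
  have "inj_on (\<lambda>(a, f). pCons a f) (UNIV \<times> (monics_of_degree n :: 'a poly set))"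
    by (auto simp: inj_on_def)
  then show ?case using Suc by (simp add: eq card_image card_cartesian_product)
qed

lemmas finite_monics_of_degree [simp] = finite_card_monics_of_degree [THEN conjunct1]
lemmas card_monics_of_degree = finite_card_monics_of_degree [THEN conjunct2]

lemma card_monics_nonzero_constant:
  "card {h \<in> monics_of_degree (Suc d). coeff h 0 \<noteq> (0 :: 'a::{finite,field})} =
   (CARD('a) - 1) * CARD('a) ^ d"
proof -
  have eq: "{h \<in> monics_of_degree (Suc d). coeff h 0 \<noteq> (0 :: 'a)} =
      (\<lambda>(a, f). pCons a f) ` ((UNIV - {0}) \<times> monics_of_degree d)" (is "?L = ?R")
  proof (intro set_eqI iffI)
    fix p :: "'a poly"
    assume "p \<in> ?L"
    then show "p \<in> ?R"
      by (cases p) (auto simp: pCons_in_monics_of_degree_iff)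
  qed (auto simp: pCons_in_monics_of_degree_iff)
  have "inj_on (\<lambda>(a, f). pCons a f) ((UNIV - {0}) \<times> (monics_of_degree d :: 'a poly set))"
    by (auto simp: inj_on_def)
  then show ?thesis
    by (simp add: eq card_image card_cartesian_product card_Diff_singleton card_monics_of_degree)
qed

lemma mult_in_monics_of_degree:
  assumes "f \<in> monics_of_degree m" "g \<in> monics_of_degree n"
  shows "f * g \<in> monics_of_degree (m + n)"
proof -
  have "f \<noteq> 0" "g \<noteq> 0" using assms by (auto simp: monics_of_degree_def)
  then show ?thesis
    using assms by (auto simp: monics_of_degree_def degree_mult_eq coeff_mult_degree_sum)
qed

lemma power_in_monics_of_degree:
  assumes "l \<in> monics_of_degree d"
  shows "l ^ k \<in> monics_of_degree (k * d)"
proof (induction k)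
  case 0
  then show ?case by (simp add: monics_of_degree_0)
next
  case (Suc k)
  then show ?case using mult_in_monics_of_degree[OF assms Suc] by simp
qed

lemma cofactor_in_monics_of_degree:
  assumes "u * g \<in> monics_of_degree n" "u \<in> monics_of_degree m"
  shows "m \<le> n \<and> g \<in> monics_of_degree (n - m)"
proof -
  have "u \<noteq> 0" "g \<noteq> 0" using assms by (auto simp: monics_of_degree_def)
  then show ?thesis
    using assms by (auto simp: monics_of_degree_def degree_mult_eq coeff_mult_degree_sum)
qed

lemma card_monic_multiples_le:
  fixes u :: "'a::{finite,field} poly"
  assumes "u \<in> monics_of_degree m"
  shows "card {f \<in> monics_of_degree n. u dvd f} \<le> CARD('a) ^ (n - m)"
proof -
  have "{f \<in> monics_of_degree n. u dvd f} \<subseteq> (\<lambda>g. u * g) ` monics_of_degree (n - m)"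
    using cofactor_in_monics_of_degree[OF _ assms] by (auto elim!: dvdE)
  then have "card {f \<in> monics_of_degree n. u dvd f} \<le>
      card ((\<lambda>g. u * g) ` monics_of_degree (n - m))"
    by (intro card_mono) auto
  also have "\<dots> \<le> CARD('a) ^ (n - m)"
    using card_image_le[of "monics_of_degree (n - m)" "\<lambda>g. u * g"]
    by (simp add: card_monics_of_degree)
  finally show ?thesis .
qed

section \<open>Polynomials divisible by the square of a nonconstant one\<close>

text \<open>The telescoping sum behind the union bound over square divisors.\<close>

lemma sum_square_divisors:
  fixes q n m :: nat
  assumes "q \<ge> 1" "2 * m \<le> n"
  shows "(\<Sum>d<m. ((q - 1) * q ^ d) * q ^ (n - 2 * Suc d)) \<le> q ^ (n - 1)"
proof -
  have "(\<Sum>d<m. ((q - 1) * q ^ d) * q ^ (n - 2 * Suc d)) + q ^ (n - 1 - m) = q ^ (n - 1)"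
    using assms(2)
  proof (induction m)
    case 0
    then show ?case by simp
  next
    case (Suc m)
    obtain r where r: "n = 2 * Suc m + r" using Suc.prems le_Suc_ex by blast
    have "(q - 1) * q ^ m * q ^ (n - 2 * Suc m) + q ^ (n - 1 - Suc m) = (q - 1 + 1) * q ^ (m + r)"
      by (simp add: r power_add algebra_simps)
    also have "\<dots> = q ^ (n - 1 - m)" using assms(1) by (simp add: r)
    finally show ?case using Suc by simp
  qed
  then show ?thesis by linarith
qed

lemma card_square_divisor_le:
  assumes "n \<ge> 2"
  shows "card {f \<in> monics_of_degree n. \<exists>l :: 'a::{finite,field} poly. l \<in> monics \<and> l ^ 2 dvd f} \<le>
    CARD('a) ^ (n - 2) + CARD('a) ^ (n - 1)" (is "card ?S \<le> _")
proof -
  let ?q = "CARD('a)"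
  define T :: "'a poly set" where "T = {f \<in> monics_of_degree n. [:0, 1:] ^ 2 dvd f}"
  define H :: "nat \<Rightarrow> 'a poly set" where "H d = {h \<in> monics_of_degree (Suc d). coeff h 0 \<noteq> 0}" for d
  define U where "U d = (\<Union>h\<in>H d. {f \<in> monics_of_degree n. h ^ 2 dvd f})" for d
  have finH: "finite (H d)" for d unfolding H_def by simp
  have sub: "?S \<subseteq> T \<union> (\<Union>d<n div 2. U d)"
  proof
    fix f assume "f \<in> ?S"
    then obtain l where f: "f \<in> monics_of_degree n" and l: "l \<in> monics" "l ^ 2 dvd f" by auto
    obtain d where d: "degree l = Suc d"
      using l(1) by (cases "degree l") (auto simp: monics_def)
    have lm: "l \<in> monics_of_degree (Suc d)"
      using l(1) d by (auto simp: monics_def monics_of_degree_def)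
    show "f \<in> T \<union> (\<Union>d<n div 2. U d)"
    proof (cases "coeff l 0 = 0")
      case True
      then have "[:0, 1:] dvd l"
        using poly_eq_0_iff_dvd[of l 0] by (simp add: poly_0_coeff_0)
      then have "[:0, 1:] ^ 2 dvd f" using l(2) dvd_power_same dvd_trans by blast
      then show ?thesis using f by (simp add: T_def)
    next
      case False
      have "2 * Suc d \<le> n"
        using cofactor_in_monics_of_degree[OF _ power_in_monics_of_degree[OF lm, of 2]] f l(2)
        by (metis dvdE)
      then have "d < n div 2" by presburger
      moreover have "f \<in> U d" using False lm f l(2) by (auto simp: U_def H_def)
      ultimately show ?thesis by blast
    qed
  qed
  have t: "[:0, 1 :: 'a:] \<in> monics_of_degree 1" by (simp add: monics_of_degree_def)
  have cT: "card T \<le> ?q ^ (n - 2)"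
    using card_monic_multiples_le[OF power_in_monics_of_degree[OF t, of 2], of n]
    by (simp add: T_def)
  have cU: "card (U d) \<le> ((?q - 1) * ?q ^ d) * ?q ^ (n - 2 * Suc d)" for d
  proof -
    have "card (U d) \<le> (\<Sum>h\<in>H d. card {f \<in> monics_of_degree n. h ^ 2 dvd f})"
      unfolding U_def by (rule card_UN_le[OF finH])
    also have "\<dots> \<le> (\<Sum>h\<in>H d. ?q ^ (n - 2 * Suc d))"
    proof (rule sum_mono)
      fix h assume "h \<in> H d"
      then have "h ^ 2 \<in> monics_of_degree (2 * Suc d)"
        unfolding H_def by (intro power_in_monics_of_degree) auto
      then show "card {f \<in> monics_of_degree n. h ^ 2 dvd f} \<le> ?q ^ (n - 2 * Suc d)"
        by (rule card_monic_multiples_le)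
    qed
    also have "\<dots> = ((?q - 1) * ?q ^ d) * ?q ^ (n - 2 * Suc d)"
      using card_monics_nonzero_constant[of d, where 'a = 'a] by (simp add: H_def)
    finally show ?thesis .
  qed
  have "card ?S \<le> card (T \<union> (\<Union>d<n div 2. U d))"
    using finH by (intro card_mono sub) (auto simp: T_def U_def)
  also have "\<dots> \<le> card T + card (\<Union>d<n div 2. U d)" by (rule card_Un_le)
  also have "card (\<Union>d<n div 2. U d) \<le> (\<Sum>d<n div 2. card (U d))" by (rule card_UN_le) simp
  also have "\<dots> \<le> (\<Sum>d<n div 2. ((?q - 1) * ?q ^ d) * ?q ^ (n - 2 * Suc d))"
    by (rule sum_mono) (rule cU)
  also have "\<dots> \<le> ?q ^ (n - 1)"
    using card_field_ge_2[where 'a = 'a] by (intro sum_square_divisors) auto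
  finally show ?thesis using cT by linarith
qed

section \<open>Multiplicities and the function \<open>omega\<close>\<close>

lemma degree_irreducible_pos:
  fixes l :: "'a::field poly"
  assumes "irreducible l"
  shows "degree l \<ge> 1"
  using assms by (metis irreducible_def is_unit_iff_degree less_one not_le)

text \<open>
  The maximum in the definition of \<open>nu\<close> exists because \<open>l\<^sup>m\<close> dividing \<open>f\<close> forces
  \<open>m \<le> degree f\<close>.
\<close>

lemma nu_greatest:
  assumes "irreducible l" "f \<noteq> 0"
  shows "l ^ nu l f dvd f"
    and "l ^ m dvd f \<Longrightarrow> m \<le> nu l f"
proof -
  have deg: "degree l \<ge> 1" by (rule degree_irreducible_pos[OF assms(1)])
  have bound: "m \<le> degree f" if "l ^ m dvd f" for m
  proof -
    have "m * 1 \<le> m * degree l" using deg by (intro mult_le_mono2)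
    also have "\<dots> = degree (l ^ m)"
      using assms(1) by (subst degree_power_eq) (auto simp: irreducible_def)
    also have "\<dots> \<le> degree f" using that assms(2) by (rule dvd_imp_degree_le)
    finally show ?thesis by simp
  qed
  show "l ^ nu l f dvd f"
    unfolding nu_def by (rule GreatestI_nat[of _ 0 "degree f"]) (auto dest: bound)
  show "l ^ m dvd f \<Longrightarrow> m \<le> nu l f"
    unfolding nu_def by (rule Greatest_le_nat[of _ m "degree f"]) (auto dest: bound)
qed

lemma omega_eq_0_if_no_square_divisor:
  assumes "k \<ge> 2" "f \<noteq> 0" "\<not> (\<exists>l. l \<in> monics \<and> l ^ 2 dvd f)"
  shows "omega k f = 0"
proof -
  have "nu l f \<noteq> k" if "l \<in> monic_irreducibles" for l
  proof
    assume k: "nu l f = k"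
    have irr: "irreducible l" and "lead_coeff l = 1"
      using that by (auto simp: monic_irreducibles_def)
    then have "l \<in> monics"
      using degree_irreducible_pos[OF irr] by (simp add: monics_def)
    moreover have "l ^ 2 dvd f"
      using nu_greatest(1)[OF irr assms(2)] k assms(1) by (metis dvd_trans le_imp_power_dvd)
    ultimately show False using assms(3) by blast
  qed
  then have "{l \<in> monic_irreducibles. nu l f = k} = {}" by blast
  then show ?thesis by (simp only: omega_def card.empty)
qed

lemma finite_omega_set:
  fixes f :: "'a::{finite,field} poly"
  assumes "k \<ge> 1" "f \<noteq> 0"
  shows "finite {l \<in> monic_irreducibles. nu l f = k}"
proof (rule finite_subset)
  show "{l \<in> monic_irreducibles. nu l f = k} \<subseteq> (\<Union>d\<le>degree f. monics_of_degree d)"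
  proof
    fix l assume l: "l \<in> {l \<in> monic_irreducibles. nu l f = k}"
    then have "l ^ k dvd f"
      using nu_greatest(1)[OF _ assms(2)] by (auto simp: monic_irreducibles_def)
    then have "l dvd f" using assms(1) by (metis dvd_power dvd_trans less_le_trans zero_less_one)
    then have "degree l \<le> degree f" using assms(2) by (rule dvd_imp_degree_le)
    then show "l \<in> (\<Union>d\<le>degree f. monics_of_degree d)"
      using l by (auto simp: monic_irreducibles_def monics_of_degree_def)
  qed
qed auto

lemma omega_pos_if:
  fixes h :: "'a::{finite,field} poly"
  assumes "k \<ge> 1" "coeff h 0 \<noteq> 0"
  shows "omega k ([:0, 1:] ^ k * h) > 0"
proof -
  let ?t = "[:0, 1 :: 'a:]"
  let ?f = "?t ^ k * h"
  have h: "h \<noteq> 0" using assms(2) by auto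
  then have f: "?f \<noteq> 0" by simp
  have irr: "irreducible ?t" by (rule irreducible_linear_field_poly) simp
  have "\<not> ?t ^ Suc k dvd ?f"
  proof
    assume "?t ^ Suc k dvd ?f"
    then have "?t dvd h" by (simp only: power_Suc2 dvd_mult_cancel_left) simp
    then show False using assms(2) poly_eq_0_iff_dvd[of h 0] by (simp add: poly_0_coeff_0)
  qed
  then have "\<not> Suc k \<le> nu ?t ?f"
    using nu_greatest(1)[OF irr f] by (meson dvd_trans le_imp_power_dvd)
  moreover have "k \<le> nu ?t ?f" using nu_greatest(2)[OF irr f] by simp
  ultimately have "?t \<in> {l \<in> monic_irreducibles. nu l ?f = k}"
    using irr by (simp add: monic_irreducibles_def)
  then show ?thesis
    unfolding omega_def using finite_omega_set[OF assms(1) f] card_gt_0_iff by blast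
qed

section \<open>Proportions of vanishing and nonvanishing \<open>omega\<close>\<close>

lemma card_omega_pos_ge:
  assumes "k \<ge> 1"
  shows "(CARD('a) - 1) * CARD('a) ^ m \<le>
    card {f \<in> monics_of_degree (k + Suc m). omega k (f :: 'a::{finite,field} poly) > 0}"
proof -
  let ?t = "[:0, 1 :: 'a:]"
  let ?H = "{h \<in> monics_of_degree (Suc m). coeff h 0 \<noteq> (0::'a)}"
  have t: "?t \<in> monics_of_degree 1" by (simp add: monics_of_degree_def)
  have "?t ^ k * h \<in> monics_of_degree (k + Suc m)" if "h \<in> ?H" for h
    using mult_in_monics_of_degree[OF power_in_monics_of_degree[OF t, of k], of h "Suc m"] that by simp
  then have "(\<lambda>h. ?t ^ k * h) ` ?H \<subseteq> {f \<in> monics_of_degree (k + Suc m). omega k f > 0}"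
    using omega_pos_if[OF assms] by blast
  then have "card ((\<lambda>h. ?t ^ k * h) ` ?H) \<le>
      card {f \<in> monics_of_degree (k + Suc m). omega k (f :: 'a poly) > 0}"
    by (intro card_mono) auto
  moreover have "inj_on (\<lambda>h. ?t ^ k * h) ?H" by (auto simp: inj_on_def)
  ultimately show ?thesis by (simp add: card_image card_monics_nonzero_constant)
qed

lemma card_omega_0_ge:
  assumes "k \<ge> 2" "n \<ge> 2"
  shows "CARD('a) ^ n \<le> 4 * card {f \<in> monics_of_degree n. omega k (f :: 'a::{finite,field} poly) = 0}"
    (is "_ \<le> 4 * card ?Z")
proof -
  let ?q = "CARD('a)"
  let ?M = "monics_of_degree n :: 'a poly set"
  let ?S = "{f \<in> ?M. \<exists>l. l \<in> monics \<and> l ^ 2 dvd f}"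
  obtain m where m: "n = m + 2" using assms(2) le_Suc_ex by (metis add.commute)
  have "f \<noteq> 0" if "f \<in> ?M" for f using that by (auto simp: monics_of_degree_def)
  then have "?M \<subseteq> ?Z \<union> ?S" using omega_eq_0_if_no_square_divisor[OF assms(1)] by blast
  then have "card ?M \<le> card (?Z \<union> ?S)" by (intro card_mono) auto
  then have 1: "?q ^ n \<le> card ?Z + card ?S"
    using card_Un_le[of ?Z ?S] by (simp add: card_monics_of_degree)
  have q: "?q \<ge> 2" by (rule card_field_ge_2)
  have 2: "2 * ?q ^ (n - 1) \<le> ?q ^ n" "4 * ?q ^ (n - 2) \<le> ?q ^ n"
    using q mult_le_mono[OF q q] by (auto simp: m mult.assoc[symmetric])
  show ?thesis using 1 2 card_square_divisor_le[OF assms(2), where 'a = 'a] by linarith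
qed

section \<open>Absence of a normal order\<close>

theorem theorem1p4:
  fixes k :: nat
  assumes "k \<ge> 2"
  shows "\<not> (\<exists>G :: 'a::{finite,field} poly \<Rightarrow> real.
            nonneg_on_monics G \<and> non_decreasing G \<and>
            has_normal_order (\<lambda>f. real (omega k f)) G)"
proof
  assume "\<exists>G :: 'a poly \<Rightarrow> real. nonneg_on_monics G \<and> non_decreasing G \<and>
            has_normal_order (\<lambda>f. real (omega k f)) G"
  then obtain G :: "'a poly \<Rightarrow> real" where mono: "non_decreasing G"
    and normal: "has_normal_order (\<lambda>f. real (omega k f)) G" by blast
  let ?q = "CARD('a)"
  define B where "B n = {f \<in> monics_of_degree n.
      \<not> ((1 - 1/2) * G f \<le> real (omega k f) \<and> real (omega k f) \<le> (1 + 1/2) * G f)}" for n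
  have q: "?q \<ge> 2" by (rule card_field_ge_2)
  have small: "(\<lambda>n. real (card (B n))) \<in> o(\<lambda>n. real ?q ^ n)"
    using normal[unfolded has_normal_order_def, rule_format, of "1/2"] by (simp add: B_def)
  \<comment> \<open>Any constant below both \<open>1/4\<close> and \<open>q\<^sup>-\<^sup>k\<^sup>-\<^sup>1\<close>, which are lower bounds for the proportions
    of \<open>\<omega>\<^sub>k = 0\<close> and \<open>\<omega>\<^sub>k > 0\<close>, would serve.\<close>
  define c where "c = 1 / real ?q ^ (k + 2)"
  have "c > 0" using q by (simp add: c_def)
  then have "\<forall>\<^sub>F n in sequentially. real (card (B n)) \<le> c * real ?q ^ n"
    using landau_o.smallD[OF small] by simp
  then obtain N where N: "\<And>n. n \<ge> N \<Longrightarrow> real (card (B n)) \<le> c * real ?q ^ n"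
    by (auto simp: eventually_sequentially)
  define n where "n = k + Suc (Suc N)"
  have "c * real ?q ^ n = real (?q ^ N)" using q by (simp add: c_def n_def power_add)
  then have B: "card (B n) \<le> ?q ^ N" using N[of n] by (simp add: n_def)
  have finB: "finite (B n)" unfolding B_def by simp

  have "?q ^ N < ?q ^ Suc N" using q by simp
  also have "\<dots> \<le> (?q - 1) * ?q ^ Suc N" using q by simp
  also have "\<dots> \<le> card {f \<in> monics_of_degree n. omega k (f :: 'a poly) > 0}"
    using card_omega_pos_ge[of k "Suc N", where 'a = 'a] assms by (simp add: n_def)
  finally have "card (B n) < card {f \<in> monics_of_degree n. omega k (f :: 'a poly) > 0}"
    using B by linarith
  then have "\<not> {f \<in> monics_of_degree n. omega k (f :: 'a poly) > 0} \<subseteq> B n"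
    using card_mono[OF finB] by (meson leD)
  then obtain f where f: "f \<in> monics_of_degree n" "omega k f > 0" "f \<notin> B n" by blast

  have "?q ^ (N + 2) < ?q ^ n" using q assms by (intro power_strict_increasing) (auto simp: n_def)
  moreover have "4 * ?q ^ N \<le> ?q ^ (N + 2)"
    using mult_le_mono[OF q q] by (simp add: mult.assoc[symmetric])
  ultimately have "4 * card (B n) < 4 * card {f \<in> monics_of_degree n. omega k (f :: 'a poly) = 0}"
    using B card_omega_0_ge[OF assms, of n, where 'a = 'a] by (simp only: n_def) linarith
  then have "\<not> {f \<in> monics_of_degree n. omega k (f :: 'a poly) = 0} \<subseteq> B n"
    using card_mono[OF finB] by (metis leD mult_le_mono2)
  then obtain g where g: "g \<in> monics_of_degree n" "omega k g = 0" "g \<notin> B n" by blast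

  have "f \<in> monics" "g \<in> monics" "degree f = degree g"
    using f(1) g(1) by (auto simp: monics_def monics_of_degree_def n_def)
  then have "G f = G g" using mono unfolding non_decreasing_def by (metis order.antisym order.refl)
  moreover have "G g \<le> 0" using g by (simp add: B_def)
  moreover have "G f > 0" using f by (auto simp: B_def)
  ultimately show False by simp
qed

end
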